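(* Let $a,b,t_1,t_2\in\mathbb{Z}_{>0}$ and $s_1,s_2\in\mathbb{Z}$ with $\frac{s_2}{t_2}>\frac{s_1}{t_1}$ and $\gcd(a,b)=\gcd(s_1,t_1)=\gcd(s_2,t_2)=1$, and let \[T=\mathrm{conv}\left(\binom{0}{0},\binom{\frac{s_1}{t_1}\frac{a}{b}}{\frac{a}{b}},\binom{\frac{s_2}{t_2}\frac{a}{b}}{\frac{a}{b}}\right)\subset\mathbb{R}^2.\] Write $l=\mathrm{lcm}(t_1,t_2)$. Then for $r\in\mathbb{Q}_{\geq 0}$: \begin{align*} \mathrm{(i)}\quad\mathrm{Q}_2(T,r)&=\frac12\frac{a^2}{b^2}\left(\frac{s_2}{t_2}-\frac{s_1}{t_1}\right),\\ \mathrm{(ii)}\quad\mathrm{Q}_1(T,r)&=\frac{a}{b}\left(\frac{t_1+t_2}{2t_1t_2}-\left(\left\{\frac{ar}{b}\right\}-\frac12\right)\left(\frac{s_2}{t_2}-\frac{s_1}{t_1}\right)\right),\\ \mathrm{(iii)}\quad\mathrm{Q}_0(T,r)&=1-\frac{1}{2}\left\{\frac{ar}{b}\right\}\left(\frac{s_2}{t_2}-\frac{s_1}{t_1}+2\right)+\frac{1}{2}\left\{\frac{ar}{b}\right\}^2\left(\frac{s_2}{t_2}-\frac{s_1}{t_1}\right)\\ &\quad+\left\{\frac{ar}{bl}\right\}l\left(\frac{t_2-1}{2t_2}+\frac{t_1-1}{2t_1}\right)\\ &\quad-\sum_{i=0}^{\left\{\lfloor ar/b\rfloor/l\right\}l}\left(\frac{s_2i}{t_2}-\left\lfloor\frac{s_2i}{t_2}\right\rfloor+\left\lceil\frac{s_1i}{t_1}\right\rceil-\frac{s_1i}{t_1}\right).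 \end{align*}
   Context: $\lfloor x\rfloor$ is the floor, $\lceil x\rceil$ the ceiling, and $\{x\}=x-\lfloor x\rfloor$ the fractional part. For a rational polytope $P\subset\mathbb{R}^n$, let $\mathrm{G}_i(P,\cdot)$ be the unique periodic functions on $\mathbb{Z}_{\ge 0}$ with $\#(kP\cap\mathbb{Z}^n)=\sum_i\mathrm{G}_i(P,k)k^i$ for $k\in\mathbb{Z}_{\ge0}$. The rational Ehrhart coefficients are $\mathrm{Q}_i(P,a'/b'):=b'^i\mathrm{G}_i(\tfrac1{b'}P,a')$ for $a'\in\mathbb{Z}_{\ge0}$, $b'\in\mathbb{Z}_{>0}$; they are well defined, periodic, and $\#(rP\cap\mathbb{Z}^n)=\sum_i\mathrm{Q}_i(P,r)r^i$ for $r\in\mathbb{Q}_{\ge0}$. *)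

theory Defs
  imports "HOL-Analysis.Analysis"
begin

definition lattice_points :: "(real ^ 'n) set" where
  "lattice_points = {x. \<forall>i. x $ i \<in> \<int>}"

definition periodic_seq :: "(nat \<Rightarrow> real) \<Rightarrow> bool" where
  "periodic_seq f \<longleftrightarrow> (\<exists>p>0. \<forall>k. f (k + p) = f k)"

(* The i-th Ehrhart coefficient is the function ehrhart_coeff P i of the dilation factor.
   The coefficients with index above the dimension are fixed to be zero: only then do the
   remaining conditions determine the family uniquely, as THE requires.  Existence holds for
   rational polytopes; for other sets P the value carries no meaning. *)
definition ehrhart_coeff :: "(real ^ 'n) set \<Rightarrow> nat \<Rightarrow> nat \<Rightarrow> real" where
  "ehrhart_coeff P = (THE G.
     (\<forall>i. periodic_seq (G i)) \<and>
     (\<forall>i>CARD('n). \<forall>k. G i k = 0) \<and>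
     (\<forall>k. real (card ((*\<^sub>R) (real k) ` P \<inter> lattice_points)) =
            (\<Sum>i\<le>CARD('n). G i k * real k ^ i)))"

(* The common value over all representations r = m / d with m \<ge> 0 and d > 0, not only the
   reduced one.  Meaningful for rational r \<ge> 0 and rational polytopes P. *)
definition rat_ehrhart_coeff :: "(real ^ 'n) set \<Rightarrow> nat \<Rightarrow> real \<Rightarrow> real" where
  "rat_ehrhart_coeff P i r = (THE q. \<forall>m d. d > 0 \<and> r = real m / real d \<longrightarrow>
     q = real d ^ i * ehrhart_coeff ((*\<^sub>R) (1 / real d) ` P) i m)"

end

theory Submission
  imports Defs
begin

text \<open>
  The dilate of \<open>T\<close> by \<open>r\<close> has height \<open>x = a r / b\<close>, and its lattice points lie on the rows
  \<open>i = 0, \<dots>, \<lfloor>x\<rfloor>\<close>, row \<open>i\<close> containing \<open>\<lfloor>s\<^sub>2 i / t\<^sub>2\<rfloor> - \<lceil>s\<^sub>1 i / t\<^sub>1\<rceil> + 1\<close> of them.  The rounding defects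
  of the rows are \<open>l\<close>-periodic in \<open>i\<close>, and their sum over a period is computed from the fact that
  \<open>i \<mapsto> s i\<close> permutes the residues modulo \<open>t\<close> when \<open>s\<close> and \<open>t\<close> are coprime.  Substituting
  \<open>\<lfloor>x\<rfloor> = x - frac x\<close> in the row sum gives a quadratic polynomial in \<open>x\<close> whose coefficients are
  periodic in \<open>x\<close>.  Applied to all \<open>T / d\<close>, this determines the coefficients because a
  quasi-polynomial has only one coefficient family.
\<close>

subsection \<open>Uniqueness of quasi-polynomial coefficients\<close>

lemma add_mult_period:
  fixes p :: nat
  assumes "\<And>k. f (k + p) = f k"
  shows "f (k + j * p) = f k"
  by (induction j) (auto simp: assms add.assoc[symmetric] add.commute[of p])

lemma periodic_seq_diff:
  assumes "periodic_seq f" "periodic_seq g"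
  shows "periodic_seq (\<lambda>k. f k - g k)"
proof -
  obtain p q where pq: "p > 0" "\<And>k. f (k + p) = f k" "q > 0" "\<And>k. g (k + q) = g k"
    using assms unfolding periodic_seq_def by blast
  have "f (k + p * q) - g (k + p * q) = f k - g k" for k
    using add_mult_period[of f, OF pq(2), of k q] add_mult_period[of g, OF pq(4), of k p]
    by (simp add: mult.commute)
  with pq(1,3) show ?thesis
    unfolding periodic_seq_def by (intro exI[of _ "p * q"]) simp
qed

text \<open>The product of the periods of \<open>f 0\<close>, ..., \<open>f n\<close> is a multiple
  of each of them, so one step freezes all the coefficients at once.\<close>

lemma periodic_seq_common_period:
  assumes "\<And>i. periodic_seq (f i)"
  obtains p where "p > 0" "\<And>i j k. i \<le> (n::nat) \<Longrightarrow> f i (k + j * p) = f i k"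
proof -
  obtain p where p: "\<And>i. p i > 0" "\<And>i k. f i (k + p i) = f i k"
    using assms unfolding periodic_seq_def by metis
  have "f i (k + j * (\<Prod>i\<le>n. p i)) = f i k" if "i \<le> n" for i j k
  proof -
    have "p i dvd (\<Prod>i\<le>n. p i)"
      using that by (intro dvd_prodI) auto
    then obtain c where "(\<Prod>i\<le>n. p i) = c * p i"
      by (metis dvdE mult.commute)
    then show ?thesis
      using add_mult_period[of "f i", OF p(2), of k "j * c"] by (simp add: mult.assoc)
  qed
  then show thesis
    using that[of "\<Prod>i\<le>n. p i"] p(1) by (simp add: prod_pos)
qed

text \<open>Along a progression \<open>k + j * p\<close> with a common period \<open>p\<close> the
  coefficients are constant. This leaves an ordinary polynomial with infinitely many roots, hence
  with zero coefficients.\<close>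

lemma quasi_polynomial_eq_0:
  fixes E :: "nat \<Rightarrow> nat \<Rightarrow> real"
  assumes "\<And>i. periodic_seq (E i)" and zero: "\<And>k. (\<Sum>i\<le>n. E i k * real k ^ i) = 0" and "i \<le> n"
  shows "E i k = 0"
proof (rule ccontr)
  assume "E i k \<noteq> 0"
  obtain p where p: "p > 0" "\<And>i j k. i \<le> n \<Longrightarrow> E i (k + j * p) = E i k"
    using periodic_seq_common_period[of E n] assms(1) by blast
  have "(\<Sum>i\<le>n. E i k * real (k + j * p) ^ i) = 0" for j
    using zero[of "k + j * p"] p(2) by simp
  then have "range (\<lambda>j. real (k + j * p)) \<subseteq> {x. (\<Sum>i\<le>n. E i k * x ^ i) = 0}"
    by blast
  moreover have "finite {x. (\<Sum>i\<le>n. E i k * x ^ i) = 0}"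
    using \<open>E i k \<noteq> 0\<close> \<open>i \<le> n\<close> by (subst polyfun_finite_roots) blast
  moreover have "infinite (range (\<lambda>j. real (k + j * p)))"
    using p(1) by (intro range_inj_infinite injI) simp
  ultimately show False
    using finite_subset by blast
qed

text \<open>Eliminates the definite description. The difference of two admissible families is a
  vanishing quasi-polynomial up to the dimension, and above it both are zero by convention.\<close>

lemma ehrhart_coeff_eqI:
  fixes P :: "(real ^ 'n) set"
  assumes "\<And>i. periodic_seq (G i)" "\<And>i k. i > CARD('n) \<Longrightarrow> G i k = 0"
    and "\<And>k. real (card ((*\<^sub>R) (real k) ` P \<inter> lattice_points)) =
           (\<Sum>i\<le>CARD('n). G i k * real k ^ i)"
  shows "ehrhart_coeff P = G"
  unfolding ehrhart_coeff_def
proof (rule the_equality)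
  fix H
  assume H: "(\<forall>i. periodic_seq (H i)) \<and> (\<forall>i>CARD('n). \<forall>k. H i k = 0) \<and>
    (\<forall>k. real (card ((*\<^sub>R) (real k) ` P \<inter> lattice_points)) =
       (\<Sum>i\<le>CARD('n). H i k * real k ^ i))"
  have "H i k - G i k = 0" if "i \<le> CARD('n)" for i k
    using that
  proof (rule quasi_polynomial_eq_0[rotated 2])
    show "periodic_seq (\<lambda>k. H i k - G i k)" for i
      using H assms(1) by (intro periodic_seq_diff) auto
    show "(\<Sum>i\<le>CARD('n). (H i k - G i k) * real k ^ i) = 0" for k
      using H assms(3)[of k] by (simp add: left_diff_distrib sum_subtractf)
  qed
  moreover have "H i k = G i k" if "i > CARD('n)" for i k
    using H assms(2) that by simp
  ultimately show "H = G"
    by (intro ext) (metis eq_iff_diff_eq_0 not_le)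
qed (use assms in auto)

text \<open>Well-definedness is part of the task: every representation of \<open>r\<close> has to
  yield the same \<open>q\<close>. That \<open>r\<close> is rational and nonnegative supplies a
  representation, which makes \<open>q\<close> unique.\<close>

lemma rat_ehrhart_coeff_eqI:
  assumes "r \<in> \<rat>" "r \<ge> 0"
    and "\<And>m d. d > 0 \<Longrightarrow> r = real m / real d \<Longrightarrow>
           real d ^ i * ehrhart_coeff ((*\<^sub>R) (1 / real d) ` P) i m = q"
  shows "rat_ehrhart_coeff P i r = q"
proof -
  obtain m d where "d \<noteq> 0" "\<bar>r\<bar> = real m / real d"
    using Rats_abs_nat_div_natE[OF assms(1)] by metis
  then have "d > 0" "r = real m / real d"
    using assms(2) by auto
  note rep = this
  show ?thesis
    unfolding rat_ehrhart_coeff_def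
  proof (rule the_equality)
    show "\<forall>m d. d > 0 \<and> r = real m / real d \<longrightarrow>
        q = real d ^ i * ehrhart_coeff ((*\<^sub>R) (1 / real d) ` P) i m"
      using assms(3)[symmetric] by blast
  next
    fix q'
    assume "\<forall>m d. d > 0 \<and> r = real m / real d \<longrightarrow>
        q' = real d ^ i * ehrhart_coeff ((*\<^sub>R) (1 / real d) ` P) i m"
    then have "q' = real d ^ i * ehrhart_coeff ((*\<^sub>R) (1 / real d) ` P) i m"
      using rep by blast
    then show "q' = q"
      using assms(3)[OF rep] by simp
  qed
qed

subsection \<open>Rounding defects of the rows\<close>

text \<open>The number of lattice points in row \<open>i\<close> is its length plus 1 minus this
  defect.\<close>

definition row_defect :: "int \<Rightarrow> int \<Rightarrow> int \<Rightarrow> int \<Rightarrow> int \<Rightarrow> real" where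
  "row_defect s1 t1 s2 t2 i = s2 * i / t2 - \<lfloor>s2 * i / t2\<rfloor> + \<lceil>s1 * i / t1\<rceil> - s1 * i / t1"

text \<open>Since the ceiling of \<open>y\<close> exceeds \<open>y\<close> by
  \<open>frac (- y)\<close>, both ends of a row can be treated by the same facts about
  \<open>frac\<close>, with slope numerators \<open>s2\<close> and \<open>- s1\<close>.\<close>

lemma row_defect_eq_frac:
  "row_defect s1 t1 s2 t2 i = frac (s2 * i / t2) + frac (- s1 * i / t1)"
  by (simp add: row_defect_def frac_def ceiling_def)

lemma frac_of_int_divide:
  fixes k t :: int
  assumes "t > 0"
  shows "frac (real_of_int k / real_of_int t) = real_of_int (k mod t) / real_of_int t"
  using assms
  by (simp add: frac_def floor_divide_of_int_eq diff_divide_distrib flip: minus_div_mult_eq_mod)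

lemma frac_divide_add_period:
  fixes s i m t :: int
  assumes "t dvd m" "t \<noteq> 0"
  shows "frac (s * (i + m) / t) = frac (s * i / t)"
proof -
  obtain c where "m = t * c"
    using assms(1) by blast
  with assms(2) have "s * (i + m) / t = s * i / t + of_int (s * c)"
    by (simp add: field_simps)
  then show ?thesis
    by (simp only: frac_add_of_int_right)
qed

lemma row_defect_add_period:
  assumes "t1 dvd m" "t2 dvd m" "t1 \<noteq> 0" "t2 \<noteq> 0"
  shows "row_defect s1 t1 s2 t2 (i + m) = row_defect s1 t1 s2 t2 i"
  using frac_divide_add_period[of t1 m "- s1" i] frac_divide_add_period[of t2 m s2 i] assms
  by (simp add: row_defect_eq_frac)

text \<open>Multiplication by \<open>s\<close> permutes the residues modulo \<open>t\<close>, so the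
  summands are \<open>j / t\<close> for \<open>j < t\<close> in another order.\<close>

lemma sum_frac_coprime:
  fixes s :: int and t :: nat
  assumes "t > 0" "coprime s (int t)"
  shows "(\<Sum>i<t. frac (s * int i / t)) = (real t - 1) / 2"
proof -
  define \<pi> where "\<pi> i = nat (s * int i mod int t)" for i
  have inj: "inj_on \<pi> {..<t}"
  proof (rule inj_onI)
    fix i j assume ij: "i \<in> {..<t}" "j \<in> {..<t}" "\<pi> i = \<pi> j"
    then have "s * int i mod int t = s * int j mod int t"
      using assms(1) by (simp add: \<pi>_def eq_nat_nat_iff)
    then have "int t dvd s * (int i - int j)"
      by (simp add: mod_eq_dvd_iff right_diff_distrib)
    then have "int t dvd int i - int j"
      using assms(2) by (simp add: coprime_commute coprime_dvd_mult_right_iff)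
    then have "int i mod int t = int j mod int t"
      by (simp add: mod_eq_dvd_iff)
    with ij show "i = j" by simp
  qed
  have "\<pi> ` {..<t} \<subseteq> {..<t}"
    using assms(1) by (auto simp: \<pi>_def nat_less_iff)
  \<comment> \<open>An injective self-map of a finite set is onto.\<close>
  with inj have img: "\<pi> ` {..<t} = {..<t}"
    by (intro endo_inj_surj) auto
  have "frac (s * int i / t) = real (\<pi> i) / t" for i
    using frac_of_int_divide[of "int t" "s * int i"] assms(1) by (simp add: \<pi>_def)
  then have "(\<Sum>i<t. frac (s * int i / t)) = (\<Sum>i<t. real (\<pi> i)) / t"
    by (simp add: sum_divide_distrib)
  also have "(\<Sum>i<t. real (\<pi> i)) = (\<Sum>i<t. real i)"
    using sum.reindex[OF inj, of real] img by simp
  also have "2 * (\<Sum>i<t. real i) = real t * (real t - 1)"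
    by (induction t) (auto simp: algebra_simps)
  then have "(\<Sum>i<t. real i) / t = (real t - 1) / 2"
    using assms(1) by (simp add: field_simps)
  finally show ?thesis .
qed

lemma sum_periodic_blocks:
  fixes f :: "nat \<Rightarrow> real"
  assumes "\<And>i. f (i + p) = f i"
  shows "(\<Sum>i<q * p. f i) = q * (\<Sum>i<p. f i)"
proof -
  have block: "(\<Sum>i = j * p..<j * p + p. f i) = (\<Sum>i<p. f i)" for j
    using sum.shift_bounds_nat_ivl[of f 0 "j * p" p] add_mult_period[of f, OF assms]
    by (simp add: add.commute atLeast0LessThan)
  have "(\<Sum>i<q * p. f i) = (\<Sum>j<q. \<Sum>i = j * p..<j * p + p. f i)"
    by (rule sum.nat_group[symmetric])
  then show ?thesis
    by (simp add: block)
qed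

text \<open>The range splits into \<open>l / t\<close> full periods, each contributing
  \<open>(t - 1) / 2\<close>. With \<open>l\<close> as a factor, the results for \<open>t1\<close>
  and \<open>t2\<close> add up over a common range.\<close>

lemma sum_frac_coprime_multiple:
  fixes s t l :: int
  assumes "t > 0" "l > 0" "t dvd l" "coprime s t"
  shows "(\<Sum>i<nat l. frac (s * int i / t)) = l * ((t - 1) / (2 * t))"
proof -
  obtain c where c: "l = c * t"
    using assms(3) by (metis dvdE mult.commute)
  then have "c > 0"
    using assms(1,2) by (simp add: zero_less_mult_iff)
  have "(\<Sum>i<nat c * nat t. frac (s * int i / t)) = nat c * (\<Sum>i<nat t. frac (s * int i / t))"
  proof (rule sum_periodic_blocks)
    show "frac (s * int (i + nat t) / t) = frac (s * int i / t)" for i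
      using frac_divide_add_period[of t t s "int i"] assms(1) by simp
  qed
  also have "(\<Sum>i<nat t. frac (s * int i / t)) = (t - 1) / 2"
    using sum_frac_coprime[of "nat t" s] assms(1,4) by simp
  also have "nat c * ((t - 1) / 2) = l * ((t - 1) / (2 * t))"
    using \<open>c > 0\<close> assms(1) by (simp add: c)
  finally show ?thesis
    using c \<open>c > 0\<close> by (simp add: nat_mult_distrib)
qed

text \<open>Each summand is the mean of \<open>j / t\<close> over the residues \<open>j\<close>
  modulo \<open>t\<close>; by the permutation argument the numerators of the slopes drop
  out.\<close>

definition mean_defect :: "int \<Rightarrow> int \<Rightarrow> real" where
  "mean_defect t1 t2 = (t2 - 1) / (2 * t2) + (t1 - 1) / (2 * t1)"

lemma sum_row_defect:
  fixes s1 s2 t1 t2 l :: int and N :: nat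
  assumes "t1 > 0" "t2 > 0" "coprime s1 t1" "coprime s2 t2" and l: "l = lcm t1 t2"
  shows "(\<Sum>i\<le>N. row_defect s1 t1 s2 t2 i) =
    (N div nat l) * l * mean_defect t1 t2 + (\<Sum>i\<le>N mod nat l. row_defect s1 t1 s2 t2 i)"
proof -
  let ?h = "\<lambda>i::nat. row_defect s1 t1 s2 t2 i"
  define q where "q = N div nat l"
  have "l > 0"
    using assms by (simp add: lcm_pos_int)
  have dvd: "t1 dvd l" "t2 dvd l"
    using l by auto
  have per: "?h (i + nat l) = ?h i" for i
    using row_defect_add_period[OF dvd] assms(1,2) \<open>l > 0\<close> by simp
  have shift: "?h (i + j * nat l) = ?h i" for i j
    by (rule add_mult_period[of ?h, OF per])
  have "(\<Sum>i<nat l. ?h i) =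
      (\<Sum>i<nat l. frac (s2 * int i / t2)) + (\<Sum>i<nat l. frac (- s1 * int i / t1))"
    by (simp add: row_defect_eq_frac sum.distrib)
  also have "\<dots> = l * mean_defect t1 t2"
    using sum_frac_coprime_multiple[of t2 l s2] sum_frac_coprime_multiple[of t1 l "- s1"]
      assms dvd \<open>l > 0\<close> by (simp add: mean_defect_def distrib_left)
  finally have block: "(\<Sum>i<nat l. ?h i) = l * mean_defect t1 t2" .
  \<comment> \<open>There are \<open>N + 1\<close> rows, so \<open>N mod nat l + 1\<close> of them
    remain after \<open>q\<close> full periods; the remainder always contains at least one
    row.\<close>
  have "{..N} = {..<q * nat l} \<union> {q * nat l..<q * nat l + Suc (N mod nat l)}"
  proof -
    have "N = q * nat l + N mod nat l"
      by (simp add: q_def)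
    then show ?thesis by auto
  qed
  then have "(\<Sum>i\<le>N. ?h i) =
      (\<Sum>i<q * nat l. ?h i) + (\<Sum>i = q * nat l..<q * nat l + Suc (N mod nat l). ?h i)"
    by (simp only:) (rule sum.union_disjoint, auto)
  also have "(\<Sum>i<q * nat l. ?h i) = q * (l * mean_defect t1 t2)"
    using sum_periodic_blocks[of ?h "nat l" q, OF per] block by simp
  also have "(\<Sum>i = q * nat l..<q * nat l + Suc (N mod nat l). ?h i) = (\<Sum>i\<le>N mod nat l. ?h i)"
    using sum.shift_bounds_nat_ivl[of ?h 0 "q * nat l" "Suc (N mod nat l)"] shift
    by (simp add: add.commute atLeast0LessThan lessThan_Suc_atMost del: sum.op_ivl_Suc)
  finally show ?thesis
    by (simp add: q_def)
qed

subsection \<open>Lattice points of the triangle\<close>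

text \<open>Describing the triangle by inequalities makes each horizontal row an explicit interval.
  Height 0 is included because the dilation factor 0 has to be counted too.\<close>

lemma convex_hull_triangle:
  fixes u v h :: real
  assumes "u < v" "h \<ge> 0"
  shows "convex hull {vector [0, 0], vector [u * h, h], vector [v * h, h] :: real ^ 2} =
    {p. 0 \<le> p $ 2 \<and> p $ 2 \<le> h \<and> u * p $ 2 \<le> p $ 1 \<and> p $ 1 \<le> v * p $ 2}"
    (is "?H = ?S")
proof
  have "convex ?S"
  proof -
    have eq: "?S = {p. axis 2 1 \<bullet> p \<ge> 0} \<inter> {p. axis 2 1 \<bullet> p \<le> h} \<inter>
        {p. (axis 1 1 - u *\<^sub>R axis 2 1) \<bullet> p \<ge> 0} \<inter> {p. (axis 1 1 - v *\<^sub>R axis 2 1) \<bullet> p \<le> 0}"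
      by (auto simp: inner_axis' inner_diff_left)
    show ?thesis
      unfolding eq by (intro convex_Int convex_halfspace_le convex_halfspace_ge)
  qed
  then show "?H \<subseteq> ?S"
    using assms by (intro hull_minimal) (auto intro: mult_right_mono)
next
  show "?S \<subseteq> ?H"
  proof
    fix p assume p: "p \<in> ?S"
    show "p \<in> ?H"
    proof (cases "h = 0")
      case True
      with p have "p = vector [0, 0]"
        by (auto simp: vec_eq_iff forall_2)
      then show ?thesis
        by (auto intro: hull_inc)
    next
      case False
      \<comment> \<open>\<open>\<beta>\<close> and \<open>\<gamma>\<close> are the barycentric
        weights of the two upper vertices, found by solving for \<open>p\<close> as their
        combination; the origin receives the remaining weight \<open>1 - p $ 2 / h\<close>.\<close>
      define \<gamma> where "\<gamma> = (p $ 1 - u * p $ 2) / ((v - u) * h)"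
      define \<beta> where "\<beta> = (v * p $ 2 - p $ 1) / ((v - u) * h)"
      have "\<beta> + \<gamma> = p $ 2 / h"
        using False assms(1) by (simp add: \<beta>_def \<gamma>_def divide_simps) (simp add: algebra_simps)
      moreover have "\<beta> * (u * h) + \<gamma> * (v * h) = p $ 1"
        using False assms(1) by (simp add: \<beta>_def \<gamma>_def divide_simps) (simp add: algebra_simps)
      moreover have "\<beta> * h + \<gamma> * h = p $ 2"
        using \<open>\<beta> + \<gamma> = p $ 2 / h\<close> False by (simp add: distrib_right[symmetric])
      ultimately have "p = (1 - p $ 2 / h) *\<^sub>R vector [0, 0] + \<beta> *\<^sub>R vector [u * h, h] +
          \<gamma> *\<^sub>R vector [v * h, h]"
        by (simp add: vec_eq_iff forall_2)
      moreover have "\<beta> \<ge> 0" "\<gamma> \<ge> 0" "1 - p $ 2 / h \<ge> 0"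
        using p assms False by (auto simp: \<beta>_def \<gamma>_def)
      ultimately show ?thesis
        unfolding convex_hull_3 using \<open>\<beta> + \<gamma> = p $ 2 / h\<close>
        by (intro CollectI exI[of _ "1 - p $ 2 / h"] exI[of _ \<beta>] exI[of _ \<gamma>]) auto
    qed
  qed
qed

lemma card_triangle_lattice_points:
  fixes u v x :: real
  assumes "u < v" "x \<ge> 0"
  shows "real (card (convex hull {vector [0, 0], vector [u * x, x], vector [v * x, x] :: real ^ 2}
      \<inter> lattice_points)) = (\<Sum>i\<le>nat \<lfloor>x\<rfloor>. \<lfloor>v * i\<rfloor> - \<lceil>u * i\<rceil> + 1)"
proof -
  let ?A = "SIGMA i : {..nat \<lfloor>x\<rfloor>}. {\<lceil>u * real i\<rceil>..\<lfloor>v * real i\<rfloor>}"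
  let ?f = "\<lambda>(i, j). vector [real_of_int j, real i] :: real ^ 2"
  have "convex hull {vector [0, 0], vector [u * x, x], vector [v * x, x] :: real ^ 2}
      \<inter> lattice_points = ?f ` ?A"
  proof (intro equalityI subsetI)
    fix p :: "real ^ 2"
    assume "p \<in> convex hull {vector [0, 0], vector [u * x, x], vector [v * x, x]} \<inter> lattice_points"
    then have p: "0 \<le> p $ 2" "p $ 2 \<le> x" "u * p $ 2 \<le> p $ 1" "p $ 1 \<le> v * p $ 2"
      and "p $ 1 \<in> \<int>" "p $ 2 \<in> \<int>"
      by (auto simp: convex_hull_triangle[OF assms] lattice_points_def)
    then obtain j i' where ji: "p $ 1 = of_int j" "p $ 2 = of_int i'"
      by (auto elim!: Ints_cases)
    define i where "i = nat i'"
    have i: "p $ 2 = real i"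
      using ji p by (simp add: i_def)
    have "p = ?f (i, j)"
      by (simp add: vec_eq_iff forall_2 i ji)
    moreover have "(i, j) \<in> ?A"
      using p by (auto simp: i ji(1) ceiling_le_iff le_floor_iff le_nat_floor)
    ultimately show "p \<in> ?f ` ?A"
      by blast
  next
    fix p assume "p \<in> ?f ` ?A"
    then obtain i j where p: "p = vector [real_of_int j, real i]" and "i \<le> nat \<lfloor>x\<rfloor>"
      and "\<lceil>u * real i\<rceil> \<le> j" "j \<le> \<lfloor>v * real i\<rfloor>"
      by auto
    moreover have "real i \<le> x"
      using \<open>i \<le> nat \<lfloor>x\<rfloor>\<close> assms(2) by (simp add: le_nat_iff le_floor_iff)
    ultimately show "p \<in> convex hull {vector [0, 0], vector [u * x, x], vector [v * x, x]}
        \<inter> lattice_points"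
      by (auto simp: convex_hull_triangle[OF assms] lattice_points_def forall_2 ceiling_le_iff
          le_floor_iff)
  qed
  moreover have "inj_on ?f ?A"
    by (auto simp: inj_on_def vec_eq_iff forall_2)
  ultimately have "card (convex hull {vector [0, 0], vector [u * x, x], vector [v * x, x] :: real ^ 2}
      \<inter> lattice_points) = (\<Sum>i\<le>nat \<lfloor>x\<rfloor>. nat (\<lfloor>v * i\<rfloor> - \<lceil>u * i\<rceil> + 1))"
    by (simp add: card_image)
  also have "int \<dots> = (\<Sum>i\<le>nat \<lfloor>x\<rfloor>. \<lfloor>v * i\<rfloor> - \<lceil>u * i\<rceil> + 1)"
  proof -
    \<comment> \<open>A row without lattice points gives exactly 0, never a negative number, so the
      truncation by \<open>nat\<close> loses nothing.\<close>
    have "\<lceil>u * real i\<rceil> \<le> \<lfloor>v * real i\<rfloor> + 1" for i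
    proof -
      have "u * real i \<le> v * real i"
        using assms(1) by (simp add: mult_right_mono)
      then show ?thesis by linarith
    qed
    then have "int (nat (\<lfloor>v * real i\<rfloor> - \<lceil>u * real i\<rceil> + 1)) = \<lfloor>v * real i\<rfloor> - \<lceil>u * real i\<rceil> + 1" for i
      by (simp add: algebra_simps)
    then show ?thesis
      by (simp only: int_sum)
  qed
  finally show ?thesis
    unfolding of_int_of_nat_eq[where 'a = real, symmetric] by (rule arg_cong)
qed

section \<open>The lattice point count as a quadratic in the height with periodic
  coefficients\<close>

definition linear_term :: "int \<Rightarrow> int \<Rightarrow> int \<Rightarrow> int \<Rightarrow> real \<Rightarrow> real" where
  "linear_term s1 t1 s2 t2 x =
    (t1 + t2) / (2 * t1 * t2) - (frac x - 1 / 2) * (s2 / t2 - s1 / t1)"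

text \<open>The upper limit of the sum is the floor of \<open>x\<close> reduced modulo
  \<open>l\<close>, in the notation of the theorem. The term with \<open>frac (x / l)\<close>
  corrects for counting the rows in full periods as \<open>x\<close>.\<close>

definition constant_term :: "int \<Rightarrow> int \<Rightarrow> int \<Rightarrow> int \<Rightarrow> int \<Rightarrow> real \<Rightarrow> real" where
  "constant_term l s1 t1 s2 t2 x =
    1 - 1 / 2 * frac x * (s2 / t2 - s1 / t1 + 2) + 1 / 2 * (frac x)\<^sup>2 * (s2 / t2 - s1 / t1)
      + frac (x / l) * l * mean_defect t1 t2
      - (\<Sum>i = 0..\<lfloor>frac (\<lfloor>x\<rfloor> / l) * l\<rfloor>. row_defect s1 t1 s2 t2 i)"

lemma linear_term_add_int: "linear_term s1 t1 s2 t2 (x + of_int m) = linear_term s1 t1 s2 t2 x"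
  by (simp add: linear_term_def)

text \<open>The shift changes \<open>x\<close>, \<open>x / l\<close> and the floor of
  \<open>x\<close> divided by \<open>l\<close> by integers, which no \<open>frac\<close>
  notices.\<close>

lemma constant_term_add_period:
  assumes "l > 0"
  shows "constant_term l s1 t1 s2 t2 (x + of_int (m * l)) = constant_term l s1 t1 s2 t2 x"
proof -
  have "(x + of_int (m * l)) / l = x / l + of_int m"
       "of_int \<lfloor>x + of_int (m * l)\<rfloor> / l = of_int \<lfloor>x\<rfloor> / l + real_of_int m"
    using assms by (simp_all only: floor_add_int[symmetric] of_int_add) (simp_all add: add_divide_distrib)
  then show ?thesis
    unfolding constant_term_def by (simp only: frac_add_of_int_right)
qed

lemma card_triangle_lattice_points_quadratic:
  fixes s1 s2 t1 t2 l :: int and x :: real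
  assumes "t1 > 0" "t2 > 0" "coprime s1 t1" "coprime s2 t2" and l: "l = lcm t1 t2"
    and less: "real_of_int s1 / t1 < real_of_int s2 / t2" and "x \<ge> 0"
  shows "real (card (convex hull {vector [0, 0], vector [s1 / t1 * x, x], vector [s2 / t2 * x, x]
        :: real ^ 2} \<inter> lattice_points)) =
    1 / 2 * (s2 / t2 - s1 / t1) * x\<^sup>2 + linear_term s1 t1 s2 t2 x * x
      + constant_term l s1 t1 s2 t2 x"
proof -
  define N where "N = nat \<lfloor>x\<rfloor>"
  define D where "D = real_of_int s2 / t2 - real_of_int s1 / t1"
  define C where "C = mean_defect t1 t2"
  define S where "S = (\<Sum>i\<le>N mod nat l. row_defect s1 t1 s2 t2 (int i))"
  have "l > 0"
    using assms by (simp add: lcm_pos_int)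
  have N: "real N = x - frac x" "\<lfloor>x\<rfloor> = int N"
    using \<open>x \<ge> 0\<close> by (simp_all add: N_def frac_def)
  \<comment> \<open>The rows in full periods: dividing the floor of \<open>x\<close> by
    \<open>l\<close> and rounding down gives the floor of \<open>x / l\<close>.\<close>
  have div: "real (N div nat l) * l = x - frac (x / l) * l"
  proof -
    have "int (N div nat l) = \<lfloor>x / l\<rfloor>"
      using \<open>l > 0\<close> N(2) floor_divide_real_eq_div[of l x] by (simp add: zdiv_int)
    then have "real (N div nat l) = x / l - frac (x / l)"
      by (metis frac_def diff_diff_eq2 add_diff_cancel_left' of_int_of_nat_eq)
    then show ?thesis
      using \<open>l > 0\<close> by (simp add: field_simps)
  qed
  have "frac (\<lfloor>x\<rfloor> / l) * l = N mod nat l"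
  proof -
    have "real_of_int (int N mod l) = real (N mod nat l)"
      using \<open>l > 0\<close> by (metis int_nat_eq of_int_of_nat_eq order_less_imp_le zmod_int)
    then show ?thesis
      using frac_of_int_divide[OF \<open>l > 0\<close>, of "int N"] \<open>l > 0\<close> N(2) by simp
  qed
  then have "\<lfloor>frac (\<lfloor>x\<rfloor> / l) * l\<rfloor> = int (N mod nat l)"
    by simp
  moreover have "(\<Sum>i = 0..int n. f i) = (\<Sum>i\<le>n. f (int i))" for n and f :: "int \<Rightarrow> real"
    by (rule sum.reindex_bij_witness[of _ int nat]) auto
  ultimately have S: "(\<Sum>i = 0..\<lfloor>frac (\<lfloor>x\<rfloor> / l) * l\<rfloor>. row_defect s1 t1 s2 t2 i) = S"
    by (simp add: S_def)
  have "real (card (convex hull {vector [0, 0], vector [s1 / t1 * x, x], vector [s2 / t2 * x, x]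
        :: real ^ 2} \<inter> lattice_points)) =
      (\<Sum>i\<le>N. real_of_int (\<lfloor>s2 / t2 * i\<rfloor> - \<lceil>s1 / t1 * i\<rceil> + 1))"
    using card_triangle_lattice_points[OF less \<open>x \<ge> 0\<close>] by (simp add: N_def)
  also have "\<dots> = (\<Sum>i\<le>N. D * i + 1 - row_defect s1 t1 s2 t2 i)"
    by (simp add: row_defect_def D_def algebra_simps)
  also have "\<dots> = D * (\<Sum>i\<le>N. real i) + (N + 1) - (\<Sum>i\<le>N. row_defect s1 t1 s2 t2 i)"
    by (simp add: sum.distrib sum_subtractf sum_distrib_left)
  also have "(\<Sum>i\<le>N. real i) = N * (N + 1) / 2"
    by (induction N) (auto simp: field_simps)
  also have "(\<Sum>i\<le>N. row_defect s1 t1 s2 t2 i) = (x - frac (x / l) * l) * C + S"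
    using sum_row_defect[OF assms(1-5), of N] div by (simp add: S_def C_def)
  \<comment> \<open>Substitute \<open>N = x - frac x\<close> and collect powers of \<open>x\<close>,
    treating the fractional parts as constants.\<close>
  also have "D * (N * (N + 1) / 2) + (N + 1) - ((x - frac (x / l) * l) * C + S) =
      1 / 2 * D * x\<^sup>2 + (1 - C - (frac x - 1 / 2) * D) * x
      + (1 - 1 / 2 * frac x * (D + 2) + 1 / 2 * (frac x)\<^sup>2 * D + frac (x / l) * l * C - S)"
    by (simp add: N(1) field_simps power2_eq_square)
  \<comment> \<open>The 1 counted in each row, less the mean defect, leaves
    \<open>1 / (2 * t1) + 1 / (2 * t2)\<close>, the boundary contribution to the linear
    term.\<close>
  also have "1 - C = (real_of_int t1 + t2) / (2 * real_of_int t1 * t2)"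
    using assms(1,2) by (simp add: C_def mean_defect_def field_simps)
  finally show ?thesis
    unfolding linear_term_def constant_term_def S C_def D_def .
qed

section \<open>Ehrhart coefficients of the triangle, integral and rational\<close>

text \<open>The dilate by \<open>k\<close> has height \<open>h * k\<close>, so the quadratic in the
  height becomes one in \<open>k\<close> after moving powers of \<open>h\<close> into the
  coefficients. Rationality of \<open>h\<close> makes them periodic in \<open>k\<close>.\<close>

lemma ehrhart_coeff_triangle:
  fixes s1 s2 t1 t2 l :: int and h :: real
  assumes "t1 > 0" "t2 > 0" "coprime s1 t1" "coprime s2 t2" and l: "l = lcm t1 t2"
    and less: "real_of_int s1 / t1 < real_of_int s2 / t2"
    and "h > 0" "h \<in> \<rat>"
  shows "ehrhart_coeff (convex hull {vector [0, 0], vector [s1 / t1 * h, h],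
        vector [s2 / t2 * h, h] :: real ^ 2}) =
    (\<lambda>i k. if i = 0 then constant_term l s1 t1 s2 t2 (h * k)
       else if i = 1 then h * linear_term s1 t1 s2 t2 (h * k)
       else if i = 2 then 1 / 2 * (s2 / t2 - s1 / t1) * h\<^sup>2 else 0)"
    (is "_ = ?G")
proof (rule ehrhart_coeff_eqI)
  have "l > 0"
    using assms by (simp add: lcm_pos_int)
  obtain m d where "d \<noteq> 0" "\<bar>h\<bar> = real m / real d"
    using Rats_abs_nat_div_natE[OF assms(8)] by metis
  \<comment> \<open>With \<open>h = m / d\<close>, this period raises the height by
    \<open>m * l\<close>, a multiple of the period \<open>l\<close> of the constant term.\<close>
  define p where "p = d * nat l"
  have "p > 0"
    using \<open>d \<noteq> 0\<close> \<open>l > 0\<close> by (simp add: p_def)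
  have "h * p = of_int (int m * l)"
    using \<open>\<bar>h\<bar> = real m / real d\<close> \<open>h > 0\<close> \<open>d \<noteq> 0\<close> \<open>l > 0\<close> by (simp add: p_def)
  then have shift: "h * real (k + p) = h * k + of_int (int m * l)" for k
    by (simp add: distrib_left)
  have "?G i (k + p) = ?G i k" for i k
    unfolding shift linear_term_add_int constant_term_add_period[OF \<open>l > 0\<close>] ..
  with \<open>p > 0\<close> show "periodic_seq (?G i)" for i
    unfolding periodic_seq_def by blast
next
  fix k :: nat
  have "(*\<^sub>R) (real k) ` (convex hull {vector [0, 0], vector [s1 / t1 * h, h],
        vector [s2 / t2 * h, h] :: real ^ 2}) =
      convex hull {vector [0, 0], vector [s1 / t1 * (h * k), h * k],
        vector [s2 / t2 * (h * k), h * k]}"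
    by (simp add: convex_hull_scaling[symmetric])
      (rule arg_cong[where f = "\<lambda>S. convex hull S"], auto simp: vec_eq_iff forall_2)
  then show "real (card ((*\<^sub>R) (real k) ` (convex hull {vector [0, 0], vector [s1 / t1 * h, h],
        vector [s2 / t2 * h, h] :: real ^ 2}) \<inter> lattice_points)) =
      (\<Sum>i\<le>CARD(2). ?G i k * real k ^ i)"
    using card_triangle_lattice_points_quadratic[OF assms(1-6), of "h * k"] \<open>h > 0\<close>
    by (simp add: numeral_2_eq_2 power_mult_distrib)
qed simp

theorem theorem3p1:
  fixes a b t1 t2 s1 s2 l :: int and r :: real and T :: "(real ^ 2) set"
  assumes "a > 0" "b > 0" "t1 > 0" "t2 > 0"
    and "real_of_int s2 / real_of_int t2 > real_of_int s1 / real_of_int t1"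
    and "gcd a b = 1" "gcd s1 t1 = 1" "gcd s2 t2 = 1"
    and "T = convex hull {vector [0, 0], vector [(s1 / t1) * (a / b), a / b],
                          vector [(s2 / t2) * (a / b), a / b]}"
    and "l = lcm t1 t2"
    and "r \<in> \<rat>" "r \<ge> 0"
  shows "rat_ehrhart_coeff T 2 r = 1 / 2 * (a\<^sup>2 / b\<^sup>2) * (s2 / t2 - s1 / t1)
    \<and> rat_ehrhart_coeff T 1 r =
        a / b * ((t1 + t2) / (2 * t1 * t2) - (frac (a * r / b) - 1 / 2) * (s2 / t2 - s1 / t1))
    \<and> rat_ehrhart_coeff T 0 r =
        1 - 1 / 2 * frac (a * r / b) * (s2 / t2 - s1 / t1 + 2)
          + 1 / 2 * (frac (a * r / b))\<^sup>2 * (s2 / t2 - s1 / t1)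
          + frac (a * r / (b * l)) * l * ((t2 - 1) / (2 * t2) + (t1 - 1) / (2 * t1))
          - (\<Sum>i = 0..\<lfloor>frac (\<lfloor>a * r / b\<rfloor> / l) * l\<rfloor>.
               s2 * i / t2 - \<lfloor>s2 * i / t2\<rfloor> + \<lceil>s1 * i / t1\<rceil> - s1 * i / t1)"
proof -
  have cop: "coprime s1 t1" "coprime s2 t2"
    using assms(7,8) by (simp_all add: coprime_iff_gcd_eq_1)
  define h where "h d = real_of_int a / b / real d" for d :: nat
  have coeff: "ehrhart_coeff ((*\<^sub>R) (1 / real d) ` T) =
    (\<lambda>i k. if i = 0 then constant_term l s1 t1 s2 t2 (h d * k)
       else if i = 1 then h d * linear_term s1 t1 s2 t2 (h d * k)
       else if i = 2 then 1 / 2 * (s2 / t2 - s1 / t1) * (h d)\<^sup>2 else 0)" if "d > 0" for d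
  proof -
    have "(*\<^sub>R) (1 / real d) ` T = convex hull {vector [0, 0], vector [s1 / t1 * h d, h d],
        vector [s2 / t2 * h d, h d]}"
      unfolding assms(9) convex_hull_scaling[symmetric]
      by (rule arg_cong[where f = "\<lambda>S. convex hull S"]) (auto simp: vec_eq_iff forall_2 h_def)
    moreover have "h d > 0" "h d \<in> \<rat>"
      using that assms(1,2) by (auto simp: h_def)
    ultimately show ?thesis
      using ehrhart_coeff_triangle[OF assms(3,4) cop assms(10) assms(5)] by simp
  qed
  \<comment> \<open>Independence of the representation: the dilate of \<open>T / d\<close> by
    \<open>m\<close> has height \<open>a * r / b\<close>, and the factor \<open>d ^ i\<close>
    cancels the denominator in \<open>h d ^ i\<close>.\<close>
  have height: "h d * real m = a * r / b" "real d * h d = a / b" if "d > 0" "r = real m / real d" for m d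
    using that by (simp_all add: h_def)
  have "rat_ehrhart_coeff T 2 r = 1 / 2 * (a\<^sup>2 / b\<^sup>2) * (s2 / t2 - s1 / t1)"
  proof (rule rat_ehrhart_coeff_eqI[OF assms(11,12)])
    fix m d :: nat assume md: "d > 0" "r = real m / real d"
    have "real d ^ 2 * (h d)\<^sup>2 = a\<^sup>2 / b\<^sup>2"
      using height(2)[OF md] by (simp add: power_mult_distrib[symmetric] power_divide)
    then have "real d ^ 2 * (1 / 2 * D * (h d)\<^sup>2) = 1 / 2 * (a\<^sup>2 / b\<^sup>2) * D" for D
      by (metis mult.assoc mult.commute)
    then show "real d ^ 2 * ehrhart_coeff ((*\<^sub>R) (1 / real d) ` T) 2 m =
        1 / 2 * (a\<^sup>2 / b\<^sup>2) * (s2 / t2 - s1 / t1)"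
      unfolding coeff[OF md(1)] by simp
  qed
  moreover have "rat_ehrhart_coeff T 1 r = a / b * linear_term s1 t1 s2 t2 (a * r / b)"
  proof (rule rat_ehrhart_coeff_eqI[OF assms(11,12)])
    fix m d :: nat assume md: "d > 0" "r = real m / real d"
    show "real d ^ 1 * ehrhart_coeff ((*\<^sub>R) (1 / real d) ` T) 1 m =
        a / b * linear_term s1 t1 s2 t2 (a * r / b)"
      unfolding coeff[OF md(1)] height(1)[OF md] by (simp add: height(2)[OF md, symmetric])
  qed
  moreover have "rat_ehrhart_coeff T 0 r = constant_term l s1 t1 s2 t2 (a * r / b)"
  proof (rule rat_ehrhart_coeff_eqI[OF assms(11,12)])
    fix m d :: nat assume md: "d > 0" "r = real m / real d"
    show "real d ^ 0 * ehrhart_coeff ((*\<^sub>R) (1 / real d) ` T) 0 m =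
        constant_term l s1 t1 s2 t2 (a * r / b)"
      unfolding coeff[OF md(1)] height(1)[OF md] by simp
  qed
  ultimately show ?thesis
    unfolding linear_term_def constant_term_def mean_defect_def row_defect_def by simp
qed

end
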